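(* Consider a run of the ASTR method, with notation as defined in the context. Suppose that: (i) there exists a constant $\kappa_1\in\mathbb{R}$ such that $F(x)\geq\kappa_1$ for all $x\in\mathbb{R}^d$; (ii) the functions $f_i$, $i=1,\dots,n$, are twice continuously differentiable and their gradients $\nabla f_i$ are Lipschitz continuous on $\mathbb{R}^d$; (iii) there exists a constant $\kappa_3>0$ such that $\Vert A^{\nu,k}\Vert_2\leq\kappa_3$ for all $\nu,k$; (iv) there exists a constant $\kappa_4\in(0,1)$ such that for all $\nu,k,r$ $$m^{\nu,k}(0)-m^{\nu,k}(d^r)\geq\kappa_4\Vert g^{\nu,k}\Vert_2\min\left(\frac{\Vert g^{\nu,k}\Vert_2}{1+\Vert A^{\nu,k}\Vert_2},\Delta_r\right).$$ Then there exists a $\nu_0\in\mathbb{N}$ such that $s^\nu=n$ holds for all $\nu\geq\nu_0$.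
   Context: Problem: minimize $F(x)=\frac1n\sum_{i=1}^n f_i(x)$ over $x\in\mathbb{R}^d$, where $n,d\in\mathbb{N}$ and $f_i\in C^2(\mathbb{R}^d,\mathbb{R})$. For nonempty $S\subseteq\{1,\dots,n\}$ let $F_S=\frac{1}{|S|}\sum_{i\in S}f_i$. Norms of vectors are Euclidean, norms of matrices are spectral norms. The ASTR method has fixed parameters $x^0\in\mathbb{R}^d$, $s^0\in\{1,\dots,n\}$, $\widehat R\in\mathbb{N}$, $\delta^0>0$, $\theta>0$, $\epsilon>0$, $\eta_1,\eta_2\in(0,1)$, $0<\gamma_1<1<\gamma_2$. All choices described as "select"/"choose" are arbitrary. Algorithm 1 (outer iterations). For $\nu=0,1,2,\dots$ (no stopping criterion): select $R^\nu\in\{1,\dots,\widehat R\}$. Compute $\widehat x^\nu,b^\nu,\delta^{\nu+1}$ by Algorithm 2 with inputs $x^\nu,s^\nu,\delta^\nu,R^\nu$. If $s^\nu<n$: set $a^\nu=F(x^\nu)-F(\widehat x^\nu)$; set $x^{\nu+1}=\widehat x^\nu$ if $a^\nu\geq0$ and $x^{\nu+1}=x^\nu$ otherwise; set $\tau^\nu=a^\nu/b^\nu$ if $b^\nu>0$ and $\tau^\nu=0$ otherwise; select $s^{\nu+1}\in\{s^\nu+1,\dots,n\}$ if $\tau^\nu<\theta$ and $s^{\nu+1}\in\{1,\dots,s^\nu\}$ otherwise. If $s^\nu=n$: set $x^{\nu+1}=\widehat x^\nu$ and $s^{\nu+1}=n$. Algorithm 2 (inner iterations). Set $x^{\nu,0}=x^\nu$,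 $\delta^{\nu,0}=\delta^\nu$, $R=R^\nu$. For $k=0,\dots,R-1$: choose a sample $S^{\nu,k}\subseteq\{1,\dots,n\}$ of size $s^\nu$ and put $F^{\nu,k}=F_{S^{\nu,k}}$, $g^{\nu,k}=\nabla F^{\nu,k}(x^{\nu,k})$. If $\Vert g^{\nu,k}\Vert_2\geq\epsilon$: compute $d^{\nu,k},\delta^{\nu,k+1}$ by Algorithm 3 with inputs $x^{\nu,k},g^{\nu,k},\delta^{\nu,k}$, set $x^{\nu,k+1}=x^{\nu,k}+d^{\nu,k}$ and $b^{\nu,k}=F^{\nu,k}(x^{\nu,k})-F^{\nu,k}(x^{\nu,k+1})$. Otherwise set $x^{\nu,k+1}=x^{\nu,k}$, $b^{\nu,k}=0$, $\delta^{\nu,k+1}=\delta^{\nu,k}$. Output $\widehat x^\nu=x^{\nu,R}$, $b^\nu=\frac1R\sum_{k=0}^{R-1}b^{\nu,k}$, $\delta^{\nu+1}=\delta^{\nu,R}$. Algorithm 3 (trust-region step). Let $A^{\nu,k}\in\mathbb{R}^{d\times d}$ be the matrix used in inner iteration $(\nu,k)$ and $$m^{\nu,k}(d)=F^{\nu,k}(x^{\nu,k})+\langle g^{\nu,k},d\rangle+\tfrac12 d^\intercal A^{\nu,k}d .$$ Set $\Delta_0=\delta^{\nu,k}$. For $r=0,1,2,\dots$: compute an (approximate) solution $d^r$, with $\Vert d^r\Vert_2\leq\Delta_r$, of $\min_d m^{\nu,k}(d)$ s.t. $\Vert d\Vert_2\leq\Delta_r$; compute $$\rho^{\nu,k}(d^r)=\frac{F^{\nu,k}(x^{\nu,k})-F^{\nu,k}(x^{\nu,k}+d^r)}{m^{\nu,k}(0)-m^{\nu,k}(d^r)};$$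 set $\Delta_{r+1}=\gamma_1\Vert d^r\Vert_2$; stop the loop at the first $r$ with $\rho^{\nu,k}(d^r)\geq\eta_1$. For this $r$, set $\Delta_+=\gamma_2\Delta_r$ if $\rho^{\nu,k}(d^r)\geq\eta_2$ and $\Vert d^r\Vert_2=\Delta_r$, and $\Delta_+=\Delta_r$ otherwise. Output $d^{\nu,k}=d^r$, $\delta^{\nu,k+1}=\Delta_+$. The quantities $d^r,\Delta_r$ depend on $(\nu,k)$ (suppressed in the notation). Statements "for all $\nu,k,r$" about quantities of Algorithm 3 range over all iterations $r$ of Algorithm 3 that are carried out in inner iterations $(\nu,k)$ in which Algorithm 3 is called (so $\Vert g^{\nu,k}\Vert_2\geq\epsilon$ there). *)

theory Defs
  imports "HOL-Analysis.Analysis"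
begin

section \<open>Calculus and linear algebra\<close>

definition gradient :: "(real^'d \<Rightarrow> real) \<Rightarrow> real^'d \<Rightarrow> real^'d" where
  "gradient \<phi> x = (THE g. GDERIV \<phi> x :> g)"

text \<open>The Hessian is the Jacobian of the gradient.\<close>

definition twice_cont_diff :: "(real^'d \<Rightarrow> real) \<Rightarrow> bool" where
  "twice_cont_diff \<phi> \<longleftrightarrow>
     (\<forall>x. \<phi> differentiable (at x)) \<and>
     (\<forall>x. gradient \<phi> differentiable (at x)) \<and>
     continuous_on UNIV (\<lambda>x. jacobian (gradient \<phi>) (at x))"

definition spectral_norm :: "real^'d^'d \<Rightarrow> real" where
  "spectral_norm A = onorm (\<lambda>v. A *v v)"

section \<open>The ASTR method\<close>

definition avg :: "(nat \<Rightarrow> real^'d \<Rightarrow> real) \<Rightarrow> nat set \<Rightarrow> real^'d \<Rightarrow> real" where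
  "avg f S x = (1 / real (card S)) * (\<Sum>i\<in>S. f i x)"

record ('d::finite) astr_params =
  x_init :: "real^'d"
  s_init :: nat
  R_max :: nat
  delta_init :: real
  theta :: real
  eps :: real
  eta1 :: real
  eta2 :: real
  gamma1 :: real
  gamma2 :: real

definition admissible_params :: "nat \<Rightarrow> ('d::finite) astr_params \<Rightarrow> bool" where
  "admissible_params n p \<longleftrightarrow>
     s_init p \<in> {1..n} \<and> delta_init p > 0 \<and> theta p > 0 \<and> eps p > 0 \<and>
     eta1 p \<in> {0<..<1} \<and> eta2 p \<in> {0<..<1} \<and>
     0 < gamma1 p \<and> gamma1 p < 1 \<and> 1 < gamma2 p"

text \<open>
  The history of a run. The indices are the outer iteration \<open>\<nu>\<close>, the inner iteration \<open>k\<close>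
  and the iteration \<open>r\<close> of the trust-region loop. All fields are total functions; their
  values at indices which the run does not reach carry no information and are never constrained.
\<close>

record ('d::finite) astr_run =
  outer_x :: "nat \<Rightarrow> real^'d"                       \<comment> \<open>\<open>x\<^sup>\<nu>\<close>\<close>
  outer_s :: "nat \<Rightarrow> nat"                             \<comment> \<open>\<open>s\<^sup>\<nu>\<close>\<close>
  outer_delta :: "nat \<Rightarrow> real"                        \<comment> \<open>\<open>\<delta>\<^sup>\<nu>\<close>\<close>
  outer_R :: "nat \<Rightarrow> nat"                             \<comment> \<open>\<open>R\<^sup>\<nu>\<close>\<close>
  inner_x :: "nat \<Rightarrow> nat \<Rightarrow> real^'d"                \<comment> \<open>\<open>x\<close> at \<open>(\<nu>,k)\<close>\<close>
  inner_delta :: "nat \<Rightarrow> nat \<Rightarrow> real"                \<comment> \<open>\<open>\<delta>\<close> at \<open>(\<nu>,k)\<close>\<close>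
  inner_S :: "nat \<Rightarrow> nat \<Rightarrow> nat set"                 \<comment> \<open>the sample \<open>S\<close> at \<open>(\<nu>,k)\<close>\<close>
  inner_A :: "nat \<Rightarrow> nat \<Rightarrow> real^'d^'d"              \<comment> \<open>the matrix \<open>A\<close> at \<open>(\<nu>,k)\<close>\<close>
  trial_d :: "nat \<Rightarrow> nat \<Rightarrow> nat \<Rightarrow> real^'d"        \<comment> \<open>\<open>d\<^sup>r\<close> at \<open>(\<nu>,k)\<close>\<close>
  trial_Delta :: "nat \<Rightarrow> nat \<Rightarrow> nat \<Rightarrow> real"        \<comment> \<open>\<open>\<Delta>\<^sub>r\<close> at \<open>(\<nu>,k)\<close>\<close>

subsection \<open>The trust-region loop\<close>

definition inner_F ::
    "(nat \<Rightarrow> real^'d \<Rightarrow> real) \<Rightarrow> ('d::finite) astr_run \<Rightarrow> nat \<Rightarrow> nat \<Rightarrow> real^'d \<Rightarrow> real" where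
  "inner_F f z \<nu> k = avg f (inner_S z \<nu> k)"

definition inner_g ::
    "(nat \<Rightarrow> real^'d \<Rightarrow> real) \<Rightarrow> ('d::finite) astr_run \<Rightarrow> nat \<Rightarrow> nat \<Rightarrow> real^'d" where
  "inner_g f z \<nu> k = gradient (inner_F f z \<nu> k) (inner_x z \<nu> k)"

definition model ::
    "(nat \<Rightarrow> real^'d \<Rightarrow> real) \<Rightarrow> ('d::finite) astr_run \<Rightarrow> nat \<Rightarrow> nat \<Rightarrow> real^'d \<Rightarrow> real" where
  "model f z \<nu> k d =
     inner_F f z \<nu> k (inner_x z \<nu> k) + inner_g f z \<nu> k \<bullet> d + 1/2 * (d \<bullet> (inner_A z \<nu> k *v d))"

definition ratio ::
    "(nat \<Rightarrow> real^'d \<Rightarrow> real) \<Rightarrow> ('d::finite) astr_run \<Rightarrow> nat \<Rightarrow> nat \<Rightarrow> real^'d \<Rightarrow> real" where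
  "ratio f z \<nu> k d =
     (inner_F f z \<nu> k (inner_x z \<nu> k) - inner_F f z \<nu> k (inner_x z \<nu> k + d))
     / (model f z \<nu> k 0 - model f z \<nu> k d)"

definition tr_called ::
    "(nat \<Rightarrow> real^'d \<Rightarrow> real) \<Rightarrow> ('d::finite) astr_params \<Rightarrow> 'd astr_run \<Rightarrow> nat \<Rightarrow> nat \<Rightarrow> bool" where
  "tr_called f p z \<nu> k \<longleftrightarrow> norm (inner_g f z \<nu> k) \<ge> eps p"

definition tr_accepted ::
    "(nat \<Rightarrow> real^'d \<Rightarrow> real) \<Rightarrow> ('d::finite) astr_params \<Rightarrow> 'd astr_run
     \<Rightarrow> nat \<Rightarrow> nat \<Rightarrow> nat \<Rightarrow> bool" where
  "tr_accepted f p z \<nu> k r \<longleftrightarrow> ratio f z \<nu> k (trial_d z \<nu> k r) \<ge> eta1 p"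

text \<open>Loop iteration \<open>r\<close> is carried out iff the loop has not stopped before.\<close>

definition tr_performed ::
    "(nat \<Rightarrow> real^'d \<Rightarrow> real) \<Rightarrow> ('d::finite) astr_params \<Rightarrow> 'd astr_run
     \<Rightarrow> nat \<Rightarrow> nat \<Rightarrow> nat \<Rightarrow> bool" where
  "tr_performed f p z \<nu> k r \<longleftrightarrow> (\<forall>q<r. \<not> tr_accepted f p z \<nu> k q)"

definition tr_loop ::
    "(nat \<Rightarrow> real^'d \<Rightarrow> real) \<Rightarrow> ('d::finite) astr_params \<Rightarrow> 'd astr_run \<Rightarrow> nat \<Rightarrow> nat \<Rightarrow> bool" where
  "tr_loop f p z \<nu> k \<longleftrightarrow>
     trial_Delta z \<nu> k 0 = inner_delta z \<nu> k \<and>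
     (\<forall>r. tr_performed f p z \<nu> k r \<longrightarrow>
        norm (trial_d z \<nu> k r) \<le> trial_Delta z \<nu> k r \<and>
        trial_Delta z \<nu> k (Suc r) = gamma1 p * norm (trial_d z \<nu> k r))"

definition tr_final_Delta ::
    "(nat \<Rightarrow> real^'d \<Rightarrow> real) \<Rightarrow> ('d::finite) astr_params \<Rightarrow> 'd astr_run
     \<Rightarrow> nat \<Rightarrow> nat \<Rightarrow> nat \<Rightarrow> real" where
  "tr_final_Delta f p z \<nu> k r =
     (if ratio f z \<nu> k (trial_d z \<nu> k r) \<ge> eta2 p \<and> norm (trial_d z \<nu> k r) = trial_Delta z \<nu> k r
      then gamma2 p * trial_Delta z \<nu> k r else trial_Delta z \<nu> k r)"

subsection \<open>Iterations which are reached\<close>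

text \<open>
  Termination of the trust-region loop is not part of the definition of a run: if the loop never
  accepts a step in some inner iteration, then no later iteration is reached.
\<close>

definition inner_completes ::
    "(nat \<Rightarrow> real^'d \<Rightarrow> real) \<Rightarrow> ('d::finite) astr_params \<Rightarrow> 'd astr_run \<Rightarrow> nat \<Rightarrow> nat \<Rightarrow> bool" where
  "inner_completes f p z \<nu> k \<longleftrightarrow> (tr_called f p z \<nu> k \<longrightarrow> (\<exists>r. tr_accepted f p z \<nu> k r))"

definition outer_reached ::
    "(nat \<Rightarrow> real^'d \<Rightarrow> real) \<Rightarrow> ('d::finite) astr_params \<Rightarrow> 'd astr_run \<Rightarrow> nat \<Rightarrow> bool" where
  "outer_reached f p z \<nu> \<longleftrightarrow> (\<forall>\<mu><\<nu>. \<forall>k<outer_R z \<mu>. inner_completes f p z \<mu> k)"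

definition inner_reached ::
    "(nat \<Rightarrow> real^'d \<Rightarrow> real) \<Rightarrow> ('d::finite) astr_params \<Rightarrow> 'd astr_run \<Rightarrow> nat \<Rightarrow> nat \<Rightarrow> bool" where
  "inner_reached f p z \<nu> k \<longleftrightarrow>
     outer_reached f p z \<nu> \<and> k < outer_R z \<nu> \<and> (\<forall>j<k. inner_completes f p z \<nu> j)"

subsection \<open>Inner and outer iterations\<close>

definition inner_step ::
    "nat \<Rightarrow> (nat \<Rightarrow> real^'d \<Rightarrow> real) \<Rightarrow> ('d::finite) astr_params \<Rightarrow> 'd astr_run
     \<Rightarrow> nat \<Rightarrow> nat \<Rightarrow> bool" where
  "inner_step n f p z \<nu> k \<longleftrightarrow>
     inner_S z \<nu> k \<subseteq> {1..n} \<and> card (inner_S z \<nu> k) = outer_s z \<nu> \<and>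
     (if tr_called f p z \<nu> k then
        tr_loop f p z \<nu> k \<and>
        (\<forall>r. tr_performed f p z \<nu> k r \<and> tr_accepted f p z \<nu> k r \<longrightarrow>
           inner_x z \<nu> (Suc k) = inner_x z \<nu> k + trial_d z \<nu> k r \<and>
           inner_delta z \<nu> (Suc k) = tr_final_Delta f p z \<nu> k r)
      else
        inner_x z \<nu> (Suc k) = inner_x z \<nu> k \<and>
        inner_delta z \<nu> (Suc k) = inner_delta z \<nu> k)"

definition inner_b ::
    "(nat \<Rightarrow> real^'d \<Rightarrow> real) \<Rightarrow> ('d::finite) astr_params \<Rightarrow> 'd astr_run \<Rightarrow> nat \<Rightarrow> nat \<Rightarrow> real" where
  "inner_b f p z \<nu> k =
     (if tr_called f p z \<nu> k
      then inner_F f z \<nu> k (inner_x z \<nu> k) - inner_F f z \<nu> k (inner_x z \<nu> (Suc k)) else 0)"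

definition outer_b ::
    "(nat \<Rightarrow> real^'d \<Rightarrow> real) \<Rightarrow> ('d::finite) astr_params \<Rightarrow> 'd astr_run \<Rightarrow> nat \<Rightarrow> real" where
  "outer_b f p z \<nu> = (1 / real (outer_R z \<nu>)) * (\<Sum>k<outer_R z \<nu>. inner_b f p z \<nu> k)"

definition x_hat :: "('d::finite) astr_run \<Rightarrow> nat \<Rightarrow> real^'d" where
  "x_hat z \<nu> = inner_x z \<nu> (outer_R z \<nu>)"

definition outer_a ::
    "nat \<Rightarrow> (nat \<Rightarrow> real^'d \<Rightarrow> real) \<Rightarrow> ('d::finite) astr_run \<Rightarrow> nat \<Rightarrow> real" where
  "outer_a n f z \<nu> = avg f {1..n} (outer_x z \<nu>) - avg f {1..n} (x_hat z \<nu>)"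

definition outer_tau ::
    "nat \<Rightarrow> (nat \<Rightarrow> real^'d \<Rightarrow> real) \<Rightarrow> ('d::finite) astr_params \<Rightarrow> 'd astr_run \<Rightarrow> nat \<Rightarrow> real" where
  "outer_tau n f p z \<nu> =
     (if outer_b f p z \<nu> > 0 then outer_a n f z \<nu> / outer_b f p z \<nu> else 0)"

definition outer_step ::
    "nat \<Rightarrow> (nat \<Rightarrow> real^'d \<Rightarrow> real) \<Rightarrow> ('d::finite) astr_params \<Rightarrow> 'd astr_run \<Rightarrow> nat \<Rightarrow> bool" where
  "outer_step n f p z \<nu> \<longleftrightarrow>
     outer_delta z (Suc \<nu>) = inner_delta z \<nu> (outer_R z \<nu>) \<and>
     (if outer_s z \<nu> < n then
        outer_x z (Suc \<nu>) = (if outer_a n f z \<nu> \<ge> 0 then x_hat z \<nu> else outer_x z \<nu>) \<and>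
        outer_s z (Suc \<nu>) \<in>
          (if outer_tau n f p z \<nu> < theta p then {outer_s z \<nu> + 1..n} else {1..outer_s z \<nu>})
      else
        outer_x z (Suc \<nu>) = x_hat z \<nu> \<and> outer_s z (Suc \<nu>) = n)"

text \<open>
  Being reached at \<open>Suc \<nu>\<close> means that all inner iterations of outer iteration \<open>\<nu>\<close> have completed.
\<close>

definition is_astr_run ::
    "nat \<Rightarrow> (nat \<Rightarrow> real^'d \<Rightarrow> real) \<Rightarrow> ('d::finite) astr_params \<Rightarrow> 'd astr_run \<Rightarrow> bool" where
  "is_astr_run n f p z \<longleftrightarrow>
     outer_x z 0 = x_init p \<and> outer_s z 0 = s_init p \<and> outer_delta z 0 = delta_init p \<and>
     (\<forall>\<nu>. outer_reached f p z \<nu> \<longrightarrow>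
        outer_R z \<nu> \<in> {1..R_max p} \<and>
        inner_x z \<nu> 0 = outer_x z \<nu> \<and> inner_delta z \<nu> 0 = outer_delta z \<nu>) \<and>
     (\<forall>\<nu> k. inner_reached f p z \<nu> k \<longrightarrow> inner_step n f p z \<nu> k) \<and>
     (\<forall>\<nu>. outer_reached f p z (Suc \<nu>) \<longrightarrow> outer_step n f p z \<nu>)"

end

theory Submission
  imports Defs
begin

text \<open>
  The theorem rests on two scales that do not depend on the iteration.

  The first is a \<^emph>\<open>floor for the trust-region radius\<close>. By the mean value theorem and the Lipschitz
  continuity of the gradients, the model and the sampled objective differ at distance \<open>\<parallel>d\<parallel>\<close> by at
  most \<open>C \<parallel>d\<parallel>\<^sup>2\<close>, whereas the predicted decrease is at least linear in the radius, because
  the gradient has norm at least \<open>\<epsilon>\<close> whenever a step is computed. Hence a short trial step is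
  always accepted (\<open>rejected_step_long\<close>). Since the radius is reset to \<open>\<gamma>\<^sub>1 \<parallel>d\<parallel>\<close> only
  after a rejection, it stays above a positive constant, while repeated rejections would shrink it
  geometrically to zero; so the trust-region loop always terminates and the run never gets stuck
  (\<open>trust_region_loop_terminates\<close>).

  The second is a \<^emph>\<open>minimal gain\<close>. A radius above the floor makes every accepted step lower the
  sampled objective by at least a constant, so the average gain \<open>b\<close> of an outer iteration is
  either \<open>0\<close> or bounded below. Therefore each outer iteration with \<open>s < n\<close> does one of two
  things: either \<open>\<tau> \<ge> \<theta>\<close>, and \<open>F\<close> drops by a fixed amount \<open>\<eta>\<close>, or \<open>\<tau> < \<theta>\<close>, and
  \<open>s\<close> increases while \<open>F\<close> does not. In both cases the potential \<open>n F(x) / \<eta> - s\<close> decreases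
  by at least \<open>1\<close> (\<open>potential_decreases\<close>). It is bounded below because \<open>F\<close> is, so \<open>s = n\<close>
  must occur, and this value is never left.
\<close>

section \<open>First-order error of averaged functions\<close>

lemma gradient_eqI:
  fixes \<phi> :: "real^'d \<Rightarrow> real"
  assumes "GDERIV \<phi> x :> g"
  shows "gradient \<phi> x = g"
  unfolding gradient_def
proof (rule the_equality)
  show "GDERIV \<phi> x :> g" by fact
  fix g' assume "GDERIV \<phi> x :> g'"
  then have "(\<lambda>h. h \<bullet> g') = (\<lambda>h. h \<bullet> g)"
    using assms unfolding gderiv_def by (rule has_derivative_unique)
  then show "g' = g"
    by (metis inner_commute vector_eq_rdot)
qed

lemma GDERIV_gradient:
  fixes \<phi> :: "real^'d \<Rightarrow> real"
  assumes "\<phi> differentiable (at x)"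
  shows "GDERIV \<phi> x :> gradient \<phi> x"
proof -
  obtain D where D: "(\<phi> has_derivative D) (at x)"
    using assms unfolding differentiable_def by blast
  then have "linear D"
    by (rule has_derivative_linear)
  then have "D h = h \<bullet> adjoint D 1" for h
    using adjoint_works[of D h 1] by simp
  then have "D = (\<lambda>h. h \<bullet> adjoint D 1)"
    by blast
  with D have "GDERIV \<phi> x :> adjoint D 1"
    unfolding gderiv_def by simp
  with gradient_eqI show ?thesis
    by metis
qed

lemma GDERIV_avg:
  fixes f :: "nat \<Rightarrow> real^'d \<Rightarrow> real"
  assumes "\<And>i. i \<in> S \<Longrightarrow> f i differentiable (at x)"
  shows "GDERIV (avg f S) x :> (1 / real (card S)) *\<^sub>R (\<Sum>i\<in>S. gradient (f i) x)"
proof -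
  have "((\<lambda>y. (1 / real (card S)) * (\<Sum>i\<in>S. f i y)) has_derivative
         (\<lambda>h. (1 / real (card S)) * (\<Sum>i\<in>S. h \<bullet> gradient (f i) x))) (at x)"
    using GDERIV_gradient[OF assms] unfolding gderiv_def
    by (intro has_derivative_mult_right has_derivative_sum) auto
  then show ?thesis
    unfolding gderiv_def avg_def[abs_def] by (simp add: inner_sum_right)
qed

text \<open>
  By the mean value theorem the increment is \<open>\<nabla>\<phi>(x + td) \<bullet> d\<close> for some \<open>t \<in> (0,1)\<close>,
  and the gradient there differs from \<open>\<nabla>\<phi>(x)\<close> by at most \<open>L \<parallel>d\<parallel>\<close>. Integrating along the
  segment would halve the constant, but only the quadratic order matters below.
\<close>
lemma first_order_error_le:
  fixes \<phi> :: "real^'d \<Rightarrow> real"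
  assumes diff: "\<And>y. \<phi> differentiable (at y)"
    and lip: "L-lipschitz_on UNIV (gradient \<phi>)"
  shows "\<bar>\<phi> (x + d) - \<phi> x - gradient \<phi> x \<bullet> d\<bar> \<le> L * (norm d)\<^sup>2"
proof -
  have "DERIV (\<lambda>t. \<phi> (x + t *\<^sub>R d)) t :> gradient \<phi> (x + t *\<^sub>R d) \<bullet> d" for t
  proof -
    have "(\<phi> has_derivative (\<lambda>h. h \<bullet> gradient \<phi> (x + t *\<^sub>R d))) (at (x + t *\<^sub>R d))"
      using GDERIV_gradient[OF diff] unfolding gderiv_def by blast
    moreover have "((\<lambda>t. x + t *\<^sub>R d) has_derivative (\<lambda>h. h *\<^sub>R d)) (at t)"
      by (auto intro!: derivative_eq_intros)
    ultimately have "((\<lambda>t. \<phi> (x + t *\<^sub>R d)) has_derivative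
        (\<lambda>h. (h *\<^sub>R d) \<bullet> gradient \<phi> (x + t *\<^sub>R d))) (at t)"
      using has_derivative_compose by fastforce
    then show ?thesis
      by (simp add: has_field_derivative_def inner_commute mult.commute[of _ "_ \<bullet> _"])
  qed
  then obtain t where t: "0 < t" "t < 1"
    and eq: "\<phi> (x + d) - \<phi> x = gradient \<phi> (x + t *\<^sub>R d) \<bullet> d"
    using MVT2[of 0 1 "\<lambda>t. \<phi> (x + t *\<^sub>R d)" "\<lambda>t. gradient \<phi> (x + t *\<^sub>R d) \<bullet> d"] by auto
  have L: "0 \<le> L"
    using lip by (rule lipschitz_on_nonneg)
  have "norm (gradient \<phi> (x + t *\<^sub>R d) - gradient \<phi> x) \<le> L * norm (t *\<^sub>R d)"
    using lipschitz_onD[OF lip, of "x + t *\<^sub>R d" x] by (simp add: dist_norm)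
  also have "\<dots> \<le> L * norm d"
    using t L by (intro mult_left_mono) (auto simp: mult_left_le_one_le)
  finally have "norm (gradient \<phi> (x + t *\<^sub>R d) - gradient \<phi> x) * norm d \<le> L * norm d * norm d"
    by (rule mult_right_mono) simp
  moreover have "\<bar>\<phi> (x + d) - \<phi> x - gradient \<phi> x \<bullet> d\<bar>
      = \<bar>(gradient \<phi> (x + t *\<^sub>R d) - gradient \<phi> x) \<bullet> d\<bar>"
    by (simp add: eq inner_diff_left)
  moreover have "\<dots> \<le> norm (gradient \<phi> (x + t *\<^sub>R d) - gradient \<phi> x) * norm d"
    by (rule Cauchy_Schwarz_ineq2)
  ultimately show ?thesis
    by (simp add: power2_eq_square mult.assoc)
qed

text \<open>
  The error of an average is the average of the errors, so one constant serves all samples. For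
  \<open>S = {}\<close> the average is the zero function, and the bound holds trivially.
\<close>
lemma avg_first_order_error_le:
  fixes f :: "nat \<Rightarrow> real^'d \<Rightarrow> real"
  assumes diff: "\<And>i y. i \<in> S \<Longrightarrow> f i differentiable (at y)"
    and err: "\<And>i. i \<in> S \<Longrightarrow> \<bar>f i (x + d) - f i x - gradient (f i) x \<bullet> d\<bar> \<le> B"
    and B: "0 \<le> B"
  shows "\<bar>avg f S (x + d) - avg f S x - gradient (avg f S) x \<bullet> d\<bar> \<le> B"
proof -
  have grad: "gradient (avg f S) x = (1 / real (card S)) *\<^sub>R (\<Sum>i\<in>S. gradient (f i) x)"
    by (rule gradient_eqI[OF GDERIV_avg]) (rule diff)
  have eq: "avg f S (x + d) - avg f S x - gradient (avg f S) x \<bullet> d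
      = (1 / real (card S)) * (\<Sum>i\<in>S. f i (x + d) - f i x - gradient (f i) x \<bullet> d)"
    unfolding grad avg_def
    by (simp add: inner_sum_left sum_subtractf right_diff_distrib diff_divide_distrib)
  have "\<bar>\<Sum>i\<in>S. f i (x + d) - f i x - gradient (f i) x \<bullet> d\<bar> \<le> (\<Sum>i\<in>S. B)"
    using err by (intro order_trans[OF sum_abs] sum_mono) auto
  then have sum_le: "\<bar>\<Sum>i\<in>S. f i (x + d) - f i x - gradient (f i) x \<bullet> d\<bar> \<le> real (card S) * B"
    by simp
  show ?thesis
  proof (cases "card S = 0")
    case False
    then show ?thesis
      unfolding eq using sum_le by (simp add: abs_mult pos_divide_le_eq mult.commute)
  qed (simp add: eq B)
qed

lemma spectral_norm_nonneg: "0 \<le> spectral_norm A"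
  unfolding spectral_norm_def by (rule onorm_pos_le) (rule matrix_vector_mul_bounded_linear)

lemma quadratic_form_le: "\<bar>d \<bullet> (A *v d)\<bar> \<le> spectral_norm A * (norm d)\<^sup>2"
proof -
  have "\<bar>d \<bullet> (A *v d)\<bar> \<le> norm d * norm (A *v d)"
    by (rule Cauchy_Schwarz_ineq2)
  also have "\<dots> \<le> norm d * (spectral_norm A * norm d)"
    unfolding spectral_norm_def
    by (intro mult_left_mono onorm matrix_vector_mul_bounded_linear) simp
  finally show ?thesis
    by (simp add: power2_eq_square algebra_simps)
qed

section \<open>Uniform bounds along a run\<close>

text \<open>
  The constants witness the hypotheses of the theorem and are fixed once, so that the bounds below
  can be written in terms of them; \<open>sample_error\<close> is what the Lipschitz continuous gradients give.
\<close>
locale bounded_astr_run =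
  fixes n :: nat
    and f :: "nat \<Rightarrow> real^'d \<Rightarrow> real"
    and p :: "('d::finite) astr_params"
    and z :: "'d astr_run"
    and L \<kappa>1 \<kappa>3 \<kappa>4 :: real
  assumes params: "admissible_params n p"
    and run: "is_astr_run n f p z"
    and F_ge: "\<And>x. avg f {1..n} x \<ge> \<kappa>1"
    and L_nonneg: "0 \<le> L"
    and sample_error: "\<And>S x d. S \<subseteq> {1..n} \<Longrightarrow>
          \<bar>avg f S (x + d) - avg f S x - gradient (avg f S) x \<bullet> d\<bar> \<le> L * (norm d)\<^sup>2"
    and \<kappa>3_pos: "0 < \<kappa>3"
    and matrix_le: "\<And>\<nu> k. inner_reached f p z \<nu> k \<Longrightarrow> tr_called f p z \<nu> k \<Longrightarrow>
          spectral_norm (inner_A z \<nu> k) \<le> \<kappa>3"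
    and \<kappa>4_pos: "0 < \<kappa>4"
    and model_decrease: "\<And>\<nu> k r. inner_reached f p z \<nu> k \<Longrightarrow> tr_called f p z \<nu> k \<Longrightarrow>
          tr_performed f p z \<nu> k r \<Longrightarrow>
          model f z \<nu> k 0 - model f z \<nu> k (trial_d z \<nu> k r)
            \<ge> \<kappa>4 * norm (inner_g f z \<nu> k)
              * min (norm (inner_g f z \<nu> k) / (1 + spectral_norm (inner_A z \<nu> k)))
                    (trial_Delta z \<nu> k r)"
begin

definition model_error :: real where
  "model_error = L + \<kappa>3"

text \<open>
  A lower bound for the threshold \<open>\<parallel>g\<parallel> / (1 + \<parallel>A\<parallel>)\<close> in the sufficient decrease condition.
\<close>
definition gradient_radius :: real where
  "gradient_radius = eps p / (1 + \<kappa>3)"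

text \<open>
  At a radius \<open>\<Delta> \<le> gradient_radius\<close> the predicted decrease is at least \<open>\<kappa>\<^sub>4 \<epsilon> \<Delta>\<close>. The
  second argument of the minimum is the length below which the model error is at most the fraction
  \<open>1 - \<eta>\<^sub>1\<close> of that decrease.
\<close>
definition safe_length :: real where
  "safe_length = min gradient_radius ((1 - eta1 p) * \<kappa>4 * eps p / model_error)"

definition radius_floor :: real where
  "radius_floor = min (delta_init p) (gamma1 p * safe_length)"

definition min_gain :: real where
  "min_gain = eta1 p * (\<kappa>4 * eps p * min gradient_radius radius_floor)"

lemma param_bounds:
  "s_init p \<in> {1..n}" "0 < delta_init p" "0 < theta p" "0 < eps p"
  "0 < eta1 p" "eta1 p < 1" "0 < gamma1 p" "gamma1 p < 1" "1 < gamma2 p"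
  using params unfolding admissible_params_def by auto

lemma model_error_pos: "0 < model_error"
  using L_nonneg \<kappa>3_pos by (simp add: model_error_def)

lemma gradient_radius_pos: "0 < gradient_radius"
  using \<kappa>3_pos param_bounds by (simp add: gradient_radius_def)

lemma safe_length_pos: "0 < safe_length"
  using gradient_radius_pos model_error_pos \<kappa>4_pos param_bounds by (simp add: safe_length_def)

lemma radius_floor_pos: "0 < radius_floor"
  using safe_length_pos param_bounds by (simp add: radius_floor_def)

lemma min_gain_pos: "0 < min_gain"
  using gradient_radius_pos radius_floor_pos \<kappa>4_pos param_bounds by (simp add: min_gain_def)

lemma inner_stepD:
  "inner_reached f p z \<nu> k \<Longrightarrow> inner_step n f p z \<nu> k"
  using run unfolding is_astr_run_def by blast

section \<open>The trust-region loop\<close>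

lemma predicted_decrease_ge:
  assumes reached: "inner_reached f p z \<nu> k" and called: "tr_called f p z \<nu> k"
    and perf: "tr_performed f p z \<nu> k r" and \<Delta>: "0 < \<Delta>" "\<Delta> \<le> trial_Delta z \<nu> k r"
  shows "\<kappa>4 * eps p * min gradient_radius \<Delta>
    \<le> model f z \<nu> k 0 - model f z \<nu> k (trial_d z \<nu> k r)"
proof -
  let ?g = "norm (inner_g f z \<nu> k)" and ?A = "spectral_norm (inner_A z \<nu> k)"
  have g: "eps p \<le> ?g"
    using called by (simp add: tr_called_def)
  have "gradient_radius \<le> ?g / (1 + ?A)"
    unfolding gradient_radius_def
    using g matrix_le[OF reached called] spectral_norm_nonneg[of "inner_A z \<nu> k"] param_bounds
    by (intro frac_le) auto
  then have "min gradient_radius \<Delta> \<le> min (?g / (1 + ?A)) (trial_Delta z \<nu> k r)"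
    using \<Delta> by linarith
  then have "\<kappa>4 * eps p * min gradient_radius \<Delta>
      \<le> \<kappa>4 * ?g * min (?g / (1 + ?A)) (trial_Delta z \<nu> k r)"
    using g \<kappa>4_pos param_bounds gradient_radius_pos \<Delta> by (intro mult_mono) auto
  with model_decrease[OF reached called perf] show ?thesis
    by linarith
qed

lemma model_error_le:
  assumes reached: "inner_reached f p z \<nu> k" and called: "tr_called f p z \<nu> k"
  shows "\<bar>(inner_F f z \<nu> k (inner_x z \<nu> k) - inner_F f z \<nu> k (inner_x z \<nu> k + d))
      - (model f z \<nu> k 0 - model f z \<nu> k d)\<bar> \<le> model_error * (norm d)\<^sup>2"
proof -
  have "inner_S z \<nu> k \<subseteq> {1..n}"
    using inner_stepD[OF reached] by (simp add: inner_step_def)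
  then have "\<bar>inner_F f z \<nu> k (inner_x z \<nu> k + d) - inner_F f z \<nu> k (inner_x z \<nu> k)
      - inner_g f z \<nu> k \<bullet> d\<bar> \<le> L * (norm d)\<^sup>2"
    unfolding inner_g_def inner_F_def by (rule sample_error)
  moreover have "\<bar>d \<bullet> (inner_A z \<nu> k *v d)\<bar> \<le> \<kappa>3 * (norm d)\<^sup>2"
    by (rule order_trans[OF quadratic_form_le mult_right_mono[OF matrix_le[OF reached called]]]) simp
  ultimately show ?thesis
    unfolding model_def model_error_def distrib_right by simp
qed

text \<open>
  A rejection means that the model overestimates the decrease by more than the fraction
  \<open>1 - \<eta>\<^sub>1\<close>. The error is quadratic and the predicted decrease linear in the step length, so
  this cannot happen for short steps.
\<close>
lemma rejected_step_long:
  assumes reached: "inner_reached f p z \<nu> k" and called: "tr_called f p z \<nu> k"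
    and perf: "tr_performed f p z \<nu> k r" and rej: "\<not> tr_accepted f p z \<nu> k r"
    and \<Delta>: "0 < trial_Delta z \<nu> k r"
  shows "safe_length < norm (trial_d z \<nu> k r)"
proof (rule ccontr)
  define d where "d = trial_d z \<nu> k r"
  define pred where "pred = model f z \<nu> k 0 - model f z \<nu> k d"
  define ared where
    "ared = inner_F f z \<nu> k (inner_x z \<nu> k) - inner_F f z \<nu> k (inner_x z \<nu> k + d)"
  assume "\<not> safe_length < norm (trial_d z \<nu> k r)"
  then have short: "norm d \<le> gradient_radius" "norm d \<le> (1 - eta1 p) * \<kappa>4 * eps p / model_error"
    by (auto simp: d_def safe_length_def)
  have "0 < \<kappa>4 * eps p * min gradient_radius (trial_Delta z \<nu> k r)"
    using \<kappa>4_pos param_bounds gradient_radius_pos \<Delta> by simp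
  with predicted_decrease_ge[OF reached called perf \<Delta> order_refl] have pred_pos: "0 < pred"
    unfolding pred_def d_def by linarith
  have "d \<noteq> 0"
    using pred_pos by (auto simp: pred_def)
  have "norm d \<le> trial_Delta z \<nu> k r"
    using inner_stepD[OF reached] called perf by (auto simp: inner_step_def tr_loop_def d_def)
  then have lin: "\<kappa>4 * eps p * norm d \<le> pred"
    using predicted_decrease_ge[OF reached called perf, of "norm d"] \<open>d \<noteq> 0\<close> short
    unfolding pred_def d_def by simp
  have "ared / pred < eta1 p"
    using rej by (simp add: tr_accepted_def ratio_def ared_def pred_def d_def)
  then have "(1 - eta1 p) * pred < pred - ared"
    using pred_pos by (simp add: field_simps)
  moreover have "pred - ared \<le> model_error * (norm d)\<^sup>2"
    using model_error_le[OF reached called, of d] unfolding pred_def ared_def by linarith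
  moreover have "model_error * norm d * norm d \<le> (1 - eta1 p) * \<kappa>4 * eps p * norm d"
    using short(2) model_error_pos by (intro mult_right_mono) (auto simp: field_simps)
  moreover have "(1 - eta1 p) * (\<kappa>4 * eps p * norm d) \<le> (1 - eta1 p) * pred"
    using lin param_bounds by (intro mult_left_mono) auto
  ultimately show False
    by (simp add: power2_eq_square mult.assoc)
qed

text \<open>
  The lower bound keeps the accepted step useful; the upper bound is what forces acceptance.
\<close>
lemma trial_radius_bounds:
  assumes reached: "inner_reached f p z \<nu> k" and called: "tr_called f p z \<nu> k"
    and floor: "radius_floor \<le> inner_delta z \<nu> k"
  shows "tr_performed f p z \<nu> k r \<Longrightarrow>
    radius_floor \<le> trial_Delta z \<nu> k r \<and> trial_Delta z \<nu> k r \<le> gamma1 p ^ r * inner_delta z \<nu> k"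
proof (induction r)
  case 0
  then show ?case
    using inner_stepD[OF reached] called floor by (simp add: inner_step_def tr_loop_def)
next
  case (Suc r)
  have perf: "tr_performed f p z \<nu> k r" and rej: "\<not> tr_accepted f p z \<nu> k r"
    using Suc.prems by (auto simp: tr_performed_def)
  note IH = Suc.IH[OF perf]
  have loop: "norm (trial_d z \<nu> k r) \<le> trial_Delta z \<nu> k r"
    "trial_Delta z \<nu> k (Suc r) = gamma1 p * norm (trial_d z \<nu> k r)"
    using inner_stepD[OF reached] called perf by (auto simp: inner_step_def tr_loop_def)
  have "safe_length < norm (trial_d z \<nu> k r)"
    using rejected_step_long[OF reached called perf rej] IH radius_floor_pos by linarith
  then have "gamma1 p * safe_length \<le> trial_Delta z \<nu> k (Suc r)"
    using loop param_bounds by simp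
  moreover have "trial_Delta z \<nu> k (Suc r) \<le> gamma1 p * (gamma1 p ^ r * inner_delta z \<nu> k)"
    using loop IH param_bounds by simp
  ultimately show ?case
    by (simp add: radius_floor_def mult.assoc)
qed

lemma trust_region_loop_terminates:
  assumes reached: "inner_reached f p z \<nu> k" and floor: "radius_floor \<le> inner_delta z \<nu> k"
  shows "inner_completes f p z \<nu> k"
proof (rule ccontr)
  assume "\<not> inner_completes f p z \<nu> k"
  then have called: "tr_called f p z \<nu> k" and "\<forall>r. tr_performed f p z \<nu> k r"
    by (auto simp: inner_completes_def tr_performed_def)
  then have "radius_floor \<le> gamma1 p ^ r * inner_delta z \<nu> k" for r
    using trial_radius_bounds[OF reached called floor, of r] by auto
  moreover have "(\<lambda>r. gamma1 p ^ r * inner_delta z \<nu> k) \<longlonglongrightarrow> 0 * inner_delta z \<nu> k"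
    using param_bounds by (intro tendsto_mult_right LIMSEQ_power_zero) simp
  ultimately have "radius_floor \<le> 0"
    using LIMSEQ_le_const[of "\<lambda>r. gamma1 p ^ r * inner_delta z \<nu> k" 0 radius_floor] by simp
  with radius_floor_pos show False
    by simp
qed

lemma inner_step_effect:
  assumes reached: "inner_reached f p z \<nu> k" and floor: "radius_floor \<le> inner_delta z \<nu> k"
  shows "radius_floor \<le> inner_delta z \<nu> (Suc k)"
    and "tr_called f p z \<nu> k \<Longrightarrow> min_gain \<le> inner_b f p z \<nu> k"
proof -
  have *: "radius_floor \<le> inner_delta z \<nu> (Suc k) \<and> min_gain \<le> inner_b f p z \<nu> k"
    if called: "tr_called f p z \<nu> k"
  proof -
    obtain q where "tr_accepted f p z \<nu> k q"
      using trust_region_loop_terminates[OF reached floor] called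
      by (auto simp: inner_completes_def)
    then obtain r where acc: "tr_accepted f p z \<nu> k r" and "\<forall>q<r. \<not> tr_accepted f p z \<nu> k q"
      using exists_least_iff[of "tr_accepted f p z \<nu> k"] by blast
    then have perf: "tr_performed f p z \<nu> k r"
      by (simp add: tr_performed_def)
    have \<Delta>: "radius_floor \<le> trial_Delta z \<nu> k r"
      using trial_radius_bounds[OF reached called floor perf] by simp
    have next_x: "inner_x z \<nu> (Suc k) = inner_x z \<nu> k + trial_d z \<nu> k r"
      and next_\<Delta>: "inner_delta z \<nu> (Suc k) = tr_final_Delta f p z \<nu> k r"
      using inner_stepD[OF reached] called acc perf by (auto simp: inner_step_def)
    have "trial_Delta z \<nu> k r \<le> gamma2 p * trial_Delta z \<nu> k r"
      using \<Delta> radius_floor_pos param_bounds by simp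
    with \<Delta> have "radius_floor \<le> inner_delta z \<nu> (Suc k)"
      unfolding next_\<Delta> tr_final_Delta_def by auto
    moreover
    define pred where "pred = model f z \<nu> k 0 - model f z \<nu> k (trial_d z \<nu> k r)"
    have pred: "\<kappa>4 * eps p * min gradient_radius radius_floor \<le> pred"
      unfolding pred_def by (rule predicted_decrease_ge[OF reached called perf radius_floor_pos \<Delta>])
    have "0 < \<kappa>4 * eps p * min gradient_radius radius_floor"
      using \<kappa>4_pos param_bounds gradient_radius_pos radius_floor_pos by simp
    with pred have "0 < pred"
      by linarith
    then have "eta1 p * pred \<le> inner_b f p z \<nu> k"
      using acc called
      by (simp add: tr_accepted_def ratio_def inner_b_def next_x pred_def[symmetric] field_simps)
    moreover have "min_gain \<le> eta1 p * pred"
      unfolding min_gain_def using pred param_bounds by (intro mult_left_mono) auto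
    ultimately show ?thesis
      by linarith
  qed
  show "tr_called f p z \<nu> k \<Longrightarrow> min_gain \<le> inner_b f p z \<nu> k"
    using * by blast
  show "radius_floor \<le> inner_delta z \<nu> (Suc k)"
  proof (cases "tr_called f p z \<nu> k")
    case False
    then show ?thesis
      using inner_stepD[OF reached] floor by (simp add: inner_step_def)
  qed (use * in blast)
qed

section \<open>Every outer iteration is reached\<close>

text \<open>
  Reaching an iteration and having a radius above the floor have to be proved together: the floor
  guarantees that the next loop terminates, and only then is the next radius determined.
\<close>
lemma inner_reached_and_floor:
  assumes "outer_reached f p z \<nu>" and "radius_floor \<le> outer_delta z \<nu>"
  shows "k \<le> outer_R z \<nu> \<Longrightarrow>
    (\<forall>j<k. inner_completes f p z \<nu> j) \<and> radius_floor \<le> inner_delta z \<nu> k"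
proof (induction k)
  case 0
  then show ?case
    using assms run by (simp add: is_astr_run_def)
next
  case (Suc k)
  then have "inner_reached f p z \<nu> k" and "radius_floor \<le> inner_delta z \<nu> k"
    using assms by (auto simp: inner_reached_def)
  then show ?case
    using Suc trust_region_loop_terminates inner_step_effect(1) by (auto simp: less_Suc_eq)
qed

lemma outer_reached_and_floor:
  "outer_reached f p z \<nu> \<and> radius_floor \<le> outer_delta z \<nu>"
proof (induction \<nu>)
  case 0
  then show ?case
    using run by (simp add: outer_reached_def is_astr_run_def radius_floor_def)
next
  case (Suc \<nu>)
  then have "(\<forall>j<outer_R z \<nu>. inner_completes f p z \<nu> j)
      \<and> radius_floor \<le> inner_delta z \<nu> (outer_R z \<nu>)"
    using inner_reached_and_floor by blast
  moreover from this have "outer_reached f p z (Suc \<nu>)"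
    using Suc by (auto simp: outer_reached_def less_Suc_eq)
  moreover from this have "outer_step n f p z \<nu>"
    using run unfolding is_astr_run_def by blast
  ultimately show ?case
    by (simp add: outer_step_def)
qed

lemma inner_iteration_facts:
  assumes "k < outer_R z \<nu>"
  shows "inner_reached f p z \<nu> k" and "radius_floor \<le> inner_delta z \<nu> k"
  using inner_reached_and_floor[of \<nu> k] outer_reached_and_floor[of \<nu>] assms
  by (auto simp: inner_reached_def)

lemma outer_stepD: "outer_step n f p z \<nu>"
  using run outer_reached_and_floor unfolding is_astr_run_def by blast

lemma outer_R_bounds: "1 \<le> outer_R z \<nu>" "outer_R z \<nu> \<le> R_max p"
proof -
  have "outer_R z \<nu> \<in> {1..R_max p}"
    using run outer_reached_and_floor unfolding is_astr_run_def by blast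
  then show "1 \<le> outer_R z \<nu>" "outer_R z \<nu> \<le> R_max p"
    by simp_all
qed

lemma sample_size_bounds: "outer_s z \<nu> \<in> {1..n}"
proof (induction \<nu>)
  case 0
  then show ?case
    using run param_bounds by (simp add: is_astr_run_def)
next
  case (Suc \<nu>)
  then show ?case
    using outer_stepD[of \<nu>] by (auto simp: outer_step_def split: if_splits)
qed

section \<open>The potential\<close>

text \<open>
  A single inner iteration in which a step is computed already gains \<open>min_gain\<close>, and the others
  do not lose; averaging divides this by at most \<open>R_max p\<close>.
\<close>
lemma outer_b_ge:
  assumes "0 < outer_b f p z \<nu>"
  shows "min_gain / real (R_max p) \<le> outer_b f p z \<nu>"
proof -
  let ?R = "outer_R z \<nu>"
  have nonneg: "0 \<le> inner_b f p z \<nu> k" if "k < ?R" for k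
    using inner_step_effect(2)[OF inner_iteration_facts[OF that]] min_gain_pos
    by (cases "tr_called f p z \<nu> k") (auto simp: inner_b_def)
  have "\<exists>k<?R. tr_called f p z \<nu> k"
  proof (rule ccontr)
    assume "\<not> ?thesis"
    then have "outer_b f p z \<nu> = 0"
      by (simp add: outer_b_def inner_b_def)
    with assms show False
      by simp
  qed
  then obtain k where k: "k < ?R" "tr_called f p z \<nu> k"
    by blast
  have "min_gain \<le> inner_b f p z \<nu> k"
    using inner_step_effect(2)[OF inner_iteration_facts[OF k(1)] k(2)] .
  also have "\<dots> \<le> (\<Sum>k<?R. inner_b f p z \<nu> k)"
    using k nonneg by (intro member_le_sum) auto
  finally have sum: "min_gain \<le> (\<Sum>k<?R. inner_b f p z \<nu> k)" .
  then have "min_gain / real (R_max p) \<le> (\<Sum>k<?R. inner_b f p z \<nu> k) / real ?R"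
    using outer_R_bounds[of \<nu>] min_gain_pos by (intro frac_le) auto
  then show ?thesis
    by (simp add: outer_b_def)
qed

definition F_drop :: real where
  "F_drop = theta p * (min_gain / real (R_max p))"

lemma F_drop_pos: "0 < F_drop"
  using outer_R_bounds[of 0] min_gain_pos param_bounds by (simp add: F_drop_def)

text \<open>
  The weight \<open>n / F_drop\<close> makes a guaranteed decrease of \<open>F\<close> outweigh any possible decrease of
  the sample size, which is at most \<open>n - 1\<close>.
\<close>
definition potential :: "nat \<Rightarrow> real" where
  "potential \<nu> = real n * avg f {1..n} (outer_x z \<nu>) / F_drop - real (outer_s z \<nu>)"

lemma potential_decreases:
  assumes "outer_s z \<nu> < n"
  shows "potential (Suc \<nu>) \<le> potential \<nu> - 1"
proof -
  let ?F = "\<lambda>\<nu>. avg f {1..n} (outer_x z \<nu>)"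
  have step: "outer_x z (Suc \<nu>) = (if outer_a n f z \<nu> \<ge> 0 then x_hat z \<nu> else outer_x z \<nu>)"
    "outer_s z (Suc \<nu>) \<in>
      (if outer_tau n f p z \<nu> < theta p then {outer_s z \<nu> + 1..n} else {1..outer_s z \<nu>})"
    using outer_stepD[of \<nu>] assms by (auto simp: outer_step_def)
  have n: "0 < real n"
    using assms by simp
  show ?thesis
  proof (cases "outer_tau n f p z \<nu> < theta p")
    case True
    have "?F (Suc \<nu>) \<le> ?F \<nu>"
      using step(1) by (simp add: outer_a_def)
    then have "real n * ?F (Suc \<nu>) / F_drop \<le> real n * ?F \<nu> / F_drop"
      using n F_drop_pos by (intro divide_right_mono mult_left_mono) auto
    moreover have "real (outer_s z \<nu>) + 1 \<le> real (outer_s z (Suc \<nu>))"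
      using step(2) True by auto
    ultimately show ?thesis
      unfolding potential_def by linarith
  next
    case False
    \<comment> \<open>The convention \<open>\<tau> = 0\<close> for \<open>b \<le> 0\<close> rules out that case, because \<open>\<theta> > 0\<close>.\<close>
    then have b: "0 < outer_b f p z \<nu>" and "theta p \<le> outer_a n f z \<nu> / outer_b f p z \<nu>"
      using param_bounds by (auto simp: outer_tau_def split: if_splits)
    then have "theta p * outer_b f p z \<nu> \<le> outer_a n f z \<nu>"
      by (simp add: field_simps)
    moreover have "F_drop \<le> theta p * outer_b f p z \<nu>"
      unfolding F_drop_def using outer_b_ge[OF b] param_bounds by (intro mult_left_mono) auto
    ultimately have a: "F_drop \<le> outer_a n f z \<nu>"
      by linarith
    then have "outer_x z (Suc \<nu>) = x_hat z \<nu>"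
      using step(1) F_drop_pos by simp
    with a have "F_drop \<le> ?F \<nu> - ?F (Suc \<nu>)"
      by (simp add: outer_a_def)
    then have "real n * F_drop \<le> real n * (?F \<nu> - ?F (Suc \<nu>))"
      using n by (intro mult_left_mono) auto
    then have "real n \<le> real n * ?F \<nu> / F_drop - real n * ?F (Suc \<nu>) / F_drop"
      using F_drop_pos by (simp add: field_simps)
    moreover have "real (outer_s z \<nu>) + 1 \<le> real n"
      using assms by auto
    moreover have "1 \<le> real (outer_s z (Suc \<nu>))"
      using sample_size_bounds[of "Suc \<nu>"] by simp
    ultimately show ?thesis
      unfolding potential_def by linarith
  qed
qed

lemma potential_ge: "real n * \<kappa>1 / F_drop - real n \<le> potential \<nu>"
proof -
  have "real n * \<kappa>1 / F_drop \<le> real n * avg f {1..n} (outer_x z \<nu>) / F_drop"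
    using F_ge F_drop_pos by (intro divide_right_mono mult_left_mono) auto
  moreover have "real (outer_s z \<nu>) \<le> real n"
    using sample_size_bounds[of \<nu>] by simp
  ultimately show ?thesis
    unfolding potential_def by linarith
qed

lemma full_sample_occurs: "\<exists>\<nu>. outer_s z \<nu> = n"
proof (rule ccontr)
  assume "\<nexists>\<nu>. outer_s z \<nu> = n"
  then have lt: "outer_s z \<nu> < n" for \<nu>
    using sample_size_bounds[of \<nu>] by (simp add: le_neq_implies_less)
  have "potential \<nu> \<le> potential 0 - real \<nu>" for \<nu>
  proof (induction \<nu>)
    case (Suc \<nu>)
    with potential_decreases[OF lt, of \<nu>] show ?case
      by simp
  qed simp
  moreover obtain \<nu> where "potential 0 - (real n * \<kappa>1 / F_drop - real n) < real \<nu>"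
    using reals_Archimedean2 by blast
  ultimately show False
    using potential_ge[of \<nu>] by (smt (verit))
qed

lemma full_sample_persists:
  assumes "outer_s z \<nu>0 = n" and "\<nu>0 \<le> \<nu>"
  shows "outer_s z \<nu> = n"
  using assms(2)
proof (induction \<nu> rule: dec_induct)
  case (step \<nu>)
  then show ?case
    using outer_stepD[of \<nu>] by (simp add: outer_step_def)
qed (rule assms)

end

section \<open>Eventual use of the full sample\<close>

theorem theorem4p8:
  fixes n :: nat
    and f :: "nat \<Rightarrow> real^'d \<Rightarrow> real"
    and p :: "('d::finite) astr_params"
    and z :: "'d astr_run"
  assumes params: "admissible_params n p"
    and run: "is_astr_run n f p z"
    and bounded_below: "\<exists>\<kappa>1::real. \<forall>x. avg f {1..n} x \<ge> \<kappa>1"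
    and smooth: "\<forall>i\<in>{1..n}. twice_cont_diff (f i) \<and> (\<exists>L. L-lipschitz_on UNIV (gradient (f i)))"
    and matrices_bounded: "\<exists>\<kappa>3>0. \<forall>\<nu> k. inner_reached f p z \<nu> k \<and> tr_called f p z \<nu> k
          \<longrightarrow> spectral_norm (inner_A z \<nu> k) \<le> \<kappa>3"
    and sufficient_decrease: "\<exists>\<kappa>4. 0 < \<kappa>4 \<and> \<kappa>4 < 1 \<and>
          (\<forall>\<nu> k r. inner_reached f p z \<nu> k \<and> tr_called f p z \<nu> k \<and> tr_performed f p z \<nu> k r
             \<longrightarrow> model f z \<nu> k 0 - model f z \<nu> k (trial_d z \<nu> k r)
                 \<ge> \<kappa>4 * norm (inner_g f z \<nu> k)
                   * min (norm (inner_g f z \<nu> k) / (1 + spectral_norm (inner_A z \<nu> k)))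
                         (trial_Delta z \<nu> k r))"
  shows "\<exists>\<nu>0. \<forall>\<nu>\<ge>\<nu>0. outer_reached f p z \<nu> \<and> outer_s z \<nu> = n"
proof -
  obtain \<kappa>1 where \<kappa>1: "\<And>x. avg f {1..n} x \<ge> \<kappa>1"
    using bounded_below by blast
  obtain \<kappa>3 where \<kappa>3: "0 < \<kappa>3" "\<And>\<nu> k. inner_reached f p z \<nu> k \<Longrightarrow> tr_called f p z \<nu> k \<Longrightarrow>
      spectral_norm (inner_A z \<nu> k) \<le> \<kappa>3"
    using matrices_bounded by blast
  obtain \<kappa>4 where \<kappa>4: "0 < \<kappa>4" "\<And>\<nu> k r. inner_reached f p z \<nu> k \<Longrightarrow> tr_called f p z \<nu> k \<Longrightarrow>
      tr_performed f p z \<nu> k r \<Longrightarrow>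
      model f z \<nu> k 0 - model f z \<nu> k (trial_d z \<nu> k r)
        \<ge> \<kappa>4 * norm (inner_g f z \<nu> k)
          * min (norm (inner_g f z \<nu> k) / (1 + spectral_norm (inner_A z \<nu> k)))
                (trial_Delta z \<nu> k r)"
    using sufficient_decrease by blast
  obtain l where l: "\<And>i. i \<in> {1..n} \<Longrightarrow> (l i)-lipschitz_on UNIV (gradient (f i))"
    using smooth by metis
  have diff: "f i differentiable (at y)" if "i \<in> {1..n}" for i y
    using smooth that by (auto simp: twice_cont_diff_def)
  have l_nonneg: "0 \<le> l i" if "i \<in> {1..n}" for i
    using l[OF that] by (rule lipschitz_on_nonneg)
  \<comment> \<open>Lipschitz constants are nonnegative, so their sum bounds each of them.\<close>
  define L where "L = (\<Sum>i=1..n. l i)"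
  have L_nonneg: "0 \<le> L"
    unfolding L_def using l_nonneg by (rule sum_nonneg)
  have sample_error: "\<bar>avg f S (x + d) - avg f S x - gradient (avg f S) x \<bullet> d\<bar> \<le> L * (norm d)\<^sup>2"
    if S: "S \<subseteq> {1..n}" for S x d
  proof (rule avg_first_order_error_le)
    fix i assume "i \<in> S"
    with S have i: "i \<in> {1..n}"
      by blast
    have "l i \<le> L"
      unfolding L_def using i l_nonneg by (intro member_le_sum) auto
    then have "l i * (norm d)\<^sup>2 \<le> L * (norm d)\<^sup>2"
      by (rule mult_right_mono) simp
    with first_order_error_le[OF diff[OF i] l[OF i], of x d]
    show "\<bar>f i (x + d) - f i x - gradient (f i) x \<bullet> d\<bar> \<le> L * (norm d)\<^sup>2"
      by linarith
  qed (use S diff L_nonneg in auto)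
  interpret bounded_astr_run n f p z L \<kappa>1 \<kappa>3 \<kappa>4
    using params run \<kappa>1 L_nonneg sample_error \<kappa>3 \<kappa>4 by unfold_locales
  obtain \<nu>0 where "outer_s z \<nu>0 = n"
    using full_sample_occurs by blast
  then show ?thesis
    using full_sample_persists outer_reached_and_floor by blast
qed

end
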